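(* For every $n\ge1$, $\beta_{n-1}(x)=\sum_{k=0}^{\lfloor\frac{n-1}2\rfloor}\frac{2^{2k+2}(2^{2k+2}-1)B_{2k+2}}{2k+2}\binom{n}{n-1-2k}x^{n-1-2k}$, where $\{B_m\}_{m\ge0}$ is the sequence of Bernoulli numbers and $\beta_{n-1}$ are the polynomials associated with $\mathfrak{gl}(1|2)\supset\mathfrak{osp}(1|2)$ defined in the context.
   Context: The base field is $\mathbb C$. $\mathfrak g=\mathfrak{gl}(1|2)$ is the Lie superalgebra of $3\times3$ complex matrices, whose first row/column index is even and whose second and third indices are odd, with supercommutator bracket. $E_{ij}$ are the matrix units. Let $p=2E_{11}+E_{22}+E_{33}$, and for $v=(a,b)\in\mathbb C^2$ let $v_{\mathfrak p}:=\begin{bmatrix} 0 & a & b \\ b & 0 & 0 \\ -a & 0 & 0 \end{bmatrix}$ and $v_{\mathfrak k}:=\begin{bmatrix} 0 & a & b \\ -b & 0 & 0 \\ a & 0 & 0 \end{bmatrix}$. Then $[v_{\mathfrak p},p]=-v_{\mathfrak k}$ and $[v_{\mathfrak k},p]=-v_{\mathfrak p}$. For $n\ge0$, $\alpha_n(x)$ and $\beta_{n-1}(x)$ (with $\beta_{-1}=0$) are the unique polynomials, independent of $v$, such that in $U(\mathfrak g)$ one has $p^nv_{\mathfrak k}=v_{\mathfrak k}\alpha_n(p)+\beta_{n-1}(p)v_{\mathfrak p}$ for all $v\in\mathbb C^2$. *)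

theory Defs
  imports
    "HOL-Analysis.Analysis"
    "HOL-Library.Poly_Mapping"
begin

section \<open>The Lie superalgebra \<open>gl(1|2)\<close>\<close>

type_synonym gl12 = "complex ^ 3 ^ 3"

definition index_parity :: "3 \<Rightarrow> nat" where
  "index_parity i = (if i = 1 then 0 else 1)"

definition hom_part :: "nat \<Rightarrow> gl12 \<Rightarrow> gl12" where
  "hom_part d x =
     (\<chi> i j. if (index_parity i + index_parity j) mod 2 = d then x $ i $ j else 0)"

definition homogeneous :: "nat \<Rightarrow> gl12 \<Rightarrow> bool" where
  "homogeneous d x \<longleftrightarrow> d < 2 \<and> hom_part d x = x"

text \<open>
  The bilinear extension of \<open>[x, y] = x y - (-1)\<^bsup>d e\<^esup> y x\<close> for \<open>x\<close>, \<open>y\<close> homogeneous of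
  degrees \<open>d\<close>, \<open>e\<close>.
\<close>
definition supercomm :: "gl12 \<Rightarrow> gl12 \<Rightarrow> gl12" where
  "supercomm x y = (\<Sum>d<2. \<Sum>e<2.
     hom_part d x ** hom_part e y - (-1) ^ (d * e) *\<^sub>R (hom_part e y ** hom_part d x))"

definition mat_unit :: "3 \<Rightarrow> 3 \<Rightarrow> gl12" where
  "mat_unit i j = (\<chi> k l. if k = i \<and> l = j then 1 else 0)"

definition p_elt :: gl12 where
  "p_elt = 2 *\<^sub>R mat_unit 1 1 + mat_unit 2 2 + mat_unit 3 3"

definition v_p :: "complex ^ 2 \<Rightarrow> gl12" where
  "v_p v = vector [vector [0, v $ 1, v $ 2],
                   vector [v $ 2, 0, 0],
                   vector [- (v $ 1), 0, 0]]"

definition v_k :: "complex ^ 2 \<Rightarrow> gl12" where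
  "v_k v = vector [vector [0, v $ 1, v $ 2],
                   vector [- (v $ 2), 0, 0],
                   vector [v $ 1, 0, 0]]"


section \<open>The universal enveloping algebra\<close>

text \<open>
  The free unital associative algebra on a set of generators is the monoid algebra of the
  free monoid. The free monoid is written additively, because multiplication of finitely
  supported functions (\<^typ>\<open>'a \<Rightarrow>\<^sub>0 'b\<close>) is convolution with respect to \<open>+\<close> on the index type.
\<close>

datatype 'a free_mon = Free_mon "'a list"

instantiation free_mon :: (type) monoid_add
begin

definition zero_free_mon :: "'a free_mon" where
  "zero_free_mon = Free_mon []"

fun plus_free_mon :: "'a free_mon \<Rightarrow> 'a free_mon \<Rightarrow> 'a free_mon" where
  "plus_free_mon (Free_mon xs) (Free_mon ys) = Free_mon (xs @ ys)"

instance
proof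
  fix a b c :: "'a free_mon"
  show "a + b + c = a + (b + c)" by (cases a; cases b; cases c) simp
  show "0 + a = a" "a + 0 = a" by (cases a; simp add: zero_free_mon_def)+
qed

end

lemma free_mon_add_eq_0_iff: "a + b = 0 \<longleftrightarrow> a = 0 \<and> b = 0" for a b :: "'a free_mon"
  by (cases a; cases b) (simp add: zero_free_mon_def)

type_synonym free_alg = "gl12 free_mon \<Rightarrow>\<^sub>0 complex"

definition fscalar :: "complex \<Rightarrow> free_alg" where
  "fscalar c = Poly_Mapping.single 0 c"

definition fgen :: "gl12 \<Rightarrow> free_alg" where
  "fgen x = Poly_Mapping.single (Free_mon [x]) 1"

text \<open>
  The generators are all elements of \<open>gl(1|2)\<close>. The linearity relations cut the free algebra
  down to the tensor algebra, the relations \<open>comm\<close> then give the enveloping algebra.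
\<close>
inductive_set env_ideal :: "free_alg set" where
  add: "fgen (x + y) - fgen x - fgen y \<in> env_ideal"
| scale: "fgen (map_matrix ((*) c) x) - fscalar c * fgen x \<in> env_ideal"
| comm: "\<lbrakk>homogeneous d x; homogeneous e y\<rbrakk> \<Longrightarrow>
    fgen x * fgen y - (-1) ^ (d * e) * (fgen y * fgen x) - fgen (supercomm x y) \<in> env_ideal"
| zero: "0 \<in> env_ideal"
| sum: "\<lbrakk>a \<in> env_ideal; b \<in> env_ideal\<rbrakk> \<Longrightarrow> a + b \<in> env_ideal"
| mult: "a \<in> env_ideal \<Longrightarrow> l * a * r \<in> env_ideal"

lemma env_ideal_uminus: "a \<in> env_ideal \<Longrightarrow> - a \<in> env_ideal"
  using env_ideal.mult[of a "-1" 1] by simp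

lemma env_ideal_minus: "a \<in> env_ideal \<Longrightarrow> b \<in> env_ideal \<Longrightarrow> a - b \<in> env_ideal"
  using env_ideal.sum[of a "- b"] env_ideal_uminus[of b] by simp

lemma lookup_mult_0:
  fixes a b :: free_alg
  shows "Poly_Mapping.lookup (a * b) 0 = Poly_Mapping.lookup a 0 * Poly_Mapping.lookup b 0"
proof -
  have "Poly_Mapping.lookup (a * b) 0 =
      Sum_any (\<lambda>l. Poly_Mapping.lookup a l * Sum_any (\<lambda>q. Poly_Mapping.lookup b q when 0 = l + q))"
    by (rule lookup_mult)
  also have "\<dots> = Sum_any (\<lambda>l :: gl12 free_mon.
      (Poly_Mapping.lookup a 0 * Poly_Mapping.lookup b 0) when l = 0)"
  proof (intro arg_cong[where f = Sum_any] ext)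
    fix l
    have "(\<lambda>q. Poly_Mapping.lookup b q when 0 = l + q) =
        (\<lambda>q. (Poly_Mapping.lookup b 0 when l = 0) when q = 0)"
      by (auto simp: when_def fun_eq_iff eq_commute[of 0 "_ + _"] free_mon_add_eq_0_iff)
    then show "Poly_Mapping.lookup a l * Sum_any (\<lambda>q. Poly_Mapping.lookup b q when 0 = l + q) =
        (Poly_Mapping.lookup a 0 * Poly_Mapping.lookup b 0 when l = 0)"
      by (simp only: Sum_any_when_equal) (simp add: when_def)
  qed
  also have "\<dots> = Poly_Mapping.lookup a 0 * Poly_Mapping.lookup b 0" by simp
  finally show ?thesis .
qed

lemma lookup_fgen_0: "Poly_Mapping.lookup (fgen x) 0 = 0"
  by (simp add: fgen_def lookup_single zero_free_mon_def)

lemma env_ideal_lookup_0: "a \<in> env_ideal \<Longrightarrow> Poly_Mapping.lookup a 0 = 0"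
  by (induction rule: env_ideal.induct)
     (simp_all add: lookup_minus lookup_add lookup_mult_0 lookup_fgen_0)

lemma one_notin_env_ideal: "1 \<notin> env_ideal"
  using env_ideal_lookup_0[of 1] by (auto simp: lookup_one)

quotient_type U_gl12 = free_alg / "\<lambda>a b. a - b \<in> env_ideal"
proof (rule equivpI)
  show "reflp (\<lambda>a b. a - b \<in> env_ideal)"
    by (rule reflpI) (simp add: env_ideal.zero)
  show "symp (\<lambda>a b. a - b \<in> env_ideal)"
    by (rule sympI) (use env_ideal_uminus in fastforce)
  show "transp (\<lambda>a b. a - b \<in> env_ideal)"
    by (rule transpI) (use env_ideal.sum in fastforce)
qed

instantiation U_gl12 :: ring_1
begin

lift_definition zero_U_gl12 :: U_gl12 is 0 .
lift_definition one_U_gl12 :: U_gl12 is 1 .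

lift_definition plus_U_gl12 :: "U_gl12 \<Rightarrow> U_gl12 \<Rightarrow> U_gl12" is "(+)"
  using env_ideal.sum by (fastforce simp: algebra_simps)

lift_definition minus_U_gl12 :: "U_gl12 \<Rightarrow> U_gl12 \<Rightarrow> U_gl12" is "(-)"
  using env_ideal_minus by (fastforce simp: algebra_simps)

lift_definition uminus_U_gl12 :: "U_gl12 \<Rightarrow> U_gl12" is uminus
  using env_ideal_uminus by (fastforce simp: algebra_simps)

lift_definition times_U_gl12 :: "U_gl12 \<Rightarrow> U_gl12 \<Rightarrow> U_gl12" is "(*)"
proof -
  fix a a' b b' :: free_alg
  assume "a - a' \<in> env_ideal" "b - b' \<in> env_ideal"
  then have "1 * (a - a') * b + a' * (b - b') * 1 \<in> env_ideal"
    by (intro env_ideal.sum env_ideal.mult)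
  also have "1 * (a - a') * b + a' * (b - b') * 1 = a * b - a' * b'"
    by (simp add: algebra_simps)
  finally show "a * b - a' * b' \<in> env_ideal" .
qed

instance
  by standard
     (transfer, use one_notin_env_ideal env_ideal_uminus in
       \<open>force simp: algebra_simps env_ideal.zero\<close>)+

end

lift_definition U_scalar :: "complex \<Rightarrow> U_gl12" is fscalar .

lift_definition \<iota> :: "gl12 \<Rightarrow> U_gl12" is fgen .

definition U_poly :: "complex poly \<Rightarrow> U_gl12 \<Rightarrow> U_gl12" where
  "U_poly q u = (\<Sum>i\<le>degree q. U_scalar (coeff q i) * u ^ i)"


section \<open>The polynomials \<open>\<alpha>\<^sub>n\<close> and \<open>\<beta>\<^sub>n\<^sub>-\<^sub>1\<close>\<close>

definition commutation_rule :: "nat \<Rightarrow> complex poly \<Rightarrow> complex poly \<Rightarrow> bool" where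
  "commutation_rule n A B \<longleftrightarrow>
     (\<forall>v. \<iota> p_elt ^ n * \<iota> (v_k v) =
          \<iota> (v_k v) * U_poly A (\<iota> p_elt) + U_poly B (\<iota> p_elt) * \<iota> (v_p v))"

text \<open>The pair \<open>(\<alpha>\<^sub>n, \<beta>\<^sub>n\<^sub>-\<^sub>1)\<close>.\<close>
definition alpha_beta :: "nat \<Rightarrow> complex poly \<times> complex poly" where
  "alpha_beta n = (THE (A, B). commutation_rule n A B)"

definition alpha_poly :: "nat \<Rightarrow> complex poly" where
  "alpha_poly n = fst (alpha_beta n)"

definition beta_poly :: "int \<Rightarrow> complex poly" where
  "beta_poly m = (if m < 0 then 0 else snd (alpha_beta (nat (m + 1))))"


section \<open>Bernoulli numbers\<close>

text \<open>Exponential generating function \<open>t / (e\<^sup>t - 1)\<close>, so \<open>B\<^sub>1 = -1/2\<close>.\<close>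
definition bernoulli :: "nat \<Rightarrow> complex" where
  "bernoulli n = fact n * fps_nth (fps_X / (fps_exp 1 - 1)) n"

end

theory Submission
  imports Defs
begin

text \<open>
  Split \<open>v\<^sub>k\<close> into its first row \<open>e\<close> and its first column \<open>f\<close>, so that \<open>v\<^sub>k = e + f\<close> and
  \<open>v\<^sub>p = e - f\<close>. These are weight vectors for the adjoint action of \<open>p\<close>, with weights \<open>1\<close> and \<open>-1\<close>.
  In the enveloping algebra \<open>q(p) e = e q(p + 1)\<close> and \<open>q(p) f = f q(p - 1)\<close> for every polynomial
  \<open>q\<close>. Moving all polynomials in \<open>p\<close> to the right turns
  \<open>p\<^sup>n v\<^sub>k = v\<^sub>k A(p) + B(p) v\<^sub>p\<close> into
    \<open>e ((p + 1)\<^sup>n - A(p) - B(p + 1)) + f ((p - 1)\<^sup>n - A(p) + B(p - 1)) = 0\<close>.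

  The two brackets must vanish separately. This is the one place where the enveloping algebra must
  be shown to be large enough, and modules over it do that: \<open>gl(1|2)\<close> has a one-parameter
  family of four-dimensional Kac modules on which \<open>e\<close> and \<open>f\<close> generically act by nonzero
  maps, while the eigenvalues of \<open>p\<close> vary with the parameter. A polynomial that occurs as a
  coefficient is therefore evaluated at every complex number (lemma \<open>row_col_independent\<close>). Hence
  the commutation rule is equivalent to the pair of polynomial identities in
  \<open>commutation_rule_iff\<close>.

  Eliminating \<open>A\<close> leaves \<open>B(x + 1) + B(x - 1) = (x + 1)\<^sup>n - (x - 1)\<^sup>n\<close>, which has at most one
  solution, by looking at the leading coefficient. In terms of exponential generating functions
  in \<open>t\<close> the right-hand side is \<open>2 sinh(t) exp(x t)\<close>, and shifting by \<open>1\<close> and \<open>-1\<close> and adding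
  multiplies \<open>tanh(t) exp(x t)\<close> by \<open>2 cosh(t)\<close>. So the solution has the generating function
  \<open>tanh(t) exp(x t)\<close>. The Bernoulli numbers enter through
  \<open>t tanh(t) = t + G(4 t) - G(2 t)\<close> with \<open>G(t) = t / (exp(t) - 1)\<close>.
\<close>

section \<open>Modules over the enveloping algebra\<close>

lemma free_alg_induct [case_names zero single add]:
  fixes a :: free_alg
  assumes "P 0" "\<And>m c. P (Poly_Mapping.single m c)" "\<And>a b. P a \<Longrightarrow> P b \<Longrightarrow> P (a + b)"
  shows "P a"
proof (induction a rule: update_induct)
  case (update f k v)
  have "Poly_Mapping.update k v f = Poly_Mapping.single k v + f"
    using update(1)
    by (intro poly_mapping_eqI) (auto simp: lookup_update lookup_add lookup_single when_def in_keys_iff)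
  then show ?case using update assms by simp
qed (use assms in simp)

text \<open>
  An action of the generators that respects the defining relations extends to words, then
  linearly to the free algebra, and descends to the quotient.
\<close>
locale gl12_module =
  fixes act :: "gl12 \<Rightarrow> complex ^ 'n \<Rightarrow> complex ^ 'n"
  assumes act_add: "act (x + y) w = act x w + act y w"
    and act_scale: "act (map_matrix ((*) c) x) w = c *s act x w"
    and act_add_right: "act x (w + w') = act x w + act x w'"
    and act_scale_right: "act x (c *s w) = c *s act x w"
    and act_comm: "\<lbrakk>homogeneous d x; homogeneous e y\<rbrakk> \<Longrightarrow>
      act (supercomm x y) w = act x (act y w) - (-1) ^ (d * e) *s act y (act x w)"
begin

fun word_act :: "gl12 free_mon \<Rightarrow> complex ^ 'n \<Rightarrow> complex ^ 'n" where
  "word_act (Free_mon xs) w = foldr act xs w"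

definition free_act :: "free_alg \<Rightarrow> complex ^ 'n \<Rightarrow> complex ^ 'n" where
  "free_act a w = (\<Sum>m. Poly_Mapping.lookup a m *s word_act m w)"

definition U_act :: "U_gl12 \<Rightarrow> complex ^ 'n \<Rightarrow> complex ^ 'n" where
  "U_act u = free_act (rep_U_gl12 u)"

lemma word_act_plus: "word_act (m + m') w = word_act m (word_act m' w)"
  by (cases m; cases m') simp

lemma word_act_zero: "word_act 0 w = w"
  by (simp add: zero_free_mon_def)

lemma word_act_add_right: "word_act m (w + w') = word_act m w + word_act m w'"
proof (cases m)
  case (Free_mon xs)
  then show ?thesis by (induction xs arbitrary: m) (simp_all add: act_add_right)
qed

lemma word_act_scale_right: "word_act m (c *s w) = c *s word_act m w"
proof (cases m)
  case (Free_mon xs)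
  then show ?thesis by (induction xs arbitrary: m) (simp_all add: act_scale_right)
qed

lemma finite_free_act_support: "finite {m. Poly_Mapping.lookup a m *s word_act m w \<noteq> 0}"
  by (rule finite_subset[OF _ finite_lookup[of a]]) auto

lemma free_act_add: "free_act (a + b) w = free_act a w + free_act b w"
  unfolding free_act_def
  by (simp add: lookup_add vec.scale_left_distrib Sum_any.distrib finite_free_act_support)

lemma free_act_single: "free_act (Poly_Mapping.single m c) w = c *s word_act m w"
proof -
  have "(\<lambda>k. Poly_Mapping.lookup (Poly_Mapping.single m c) k *s word_act k w)
      = (\<lambda>k. (c *s word_act m w) when k = m)"
    by (auto simp: lookup_single when_def)
  then show ?thesis unfolding free_act_def by (simp only: Sum_any_when_equal)
qed

lemma free_act_zero: "free_act 0 w = 0"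
  by (simp add: free_act_def)

lemma free_act_diff: "free_act (a - b) w = free_act a w - free_act b w"
  using free_act_add[of "a - b" b w] by simp

lemma free_act_add_right: "free_act a (w + w') = free_act a w + free_act a w'"
  by (induction a rule: free_alg_induct)
     (simp_all add: free_act_zero free_act_single free_act_add word_act_add_right vec.scale_right_distrib)

lemma free_act_scale_right: "free_act a (c *s w) = c *s free_act a w"
  by (induction a rule: free_alg_induct)
     (simp_all add: free_act_zero free_act_single free_act_add word_act_scale_right
        vec.scale_right_distrib mult.commute)

lemma free_act_zero_right: "free_act a 0 = 0"
  using free_act_scale_right[of a 0 0] by simp

lemma free_act_mult: "free_act (a * b) w = free_act a (free_act b w)"
proof (induction a rule: free_alg_induct)
  case (single m c)
  show ?case
    by (induction b rule: free_alg_induct)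
       (simp_all add: free_act_zero free_act_zero_right free_act_single mult_single word_act_plus
          word_act_scale_right distrib_left free_act_add free_act_add_right)
qed (simp_all add: free_act_zero free_act_add distrib_right)

lemma free_act_fgen: "free_act (fgen x) w = act x w"
  by (simp add: fgen_def free_act_single)

lemma free_act_fscalar: "free_act (fscalar c) w = c *s w"
  by (simp add: fscalar_def free_act_single word_act_zero)

text \<open>
  Only the three families of relations have to be checked. Multiples of an element that acts by
  zero also act by zero because the free algebra acts multiplicatively and linearly.
\<close>
lemma free_act_env_ideal: "a \<in> env_ideal \<Longrightarrow> free_act a w = 0"
proof (induction arbitrary: w rule: env_ideal.induct)
  case (comm d x e y)
  \<comment> \<open>The sign in the relation is an element of the free algebra; as a scalar it acts by itself.\<close>
  have "(-1 :: free_alg) ^ k = fscalar ((-1) ^ k)" for k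
    by (cases "even k") (simp_all add: fscalar_def single_uminus)
  then show ?case
    by (simp add: free_act_diff free_act_mult free_act_fgen free_act_fscalar act_comm[OF comm])
qed (simp_all add: free_act_diff free_act_add free_act_mult free_act_fgen free_act_fscalar
       free_act_zero free_act_zero_right act_add act_scale)

lemma U_act_abs: "U_act (abs_U_gl12 a) w = free_act a w"
proof -
  have "rep_U_gl12 (abs_U_gl12 a) - a \<in> env_ideal"
    using rep_abs_rsp_left[OF Quotient3_U_gl12, of a a] env_ideal.zero by simp
  then show ?thesis
    using free_act_env_ideal[of "rep_U_gl12 (abs_U_gl12 a) - a" w]
    by (simp add: U_act_def free_act_diff)
qed

lemma U_act_simps:
  shows U_act_zero: "U_act 0 w = 0"
    and U_act_\<iota>: "U_act (\<iota> x) w = act x w"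
    and U_act_scalar: "U_act (U_scalar c) w = c *s w"
  by (simp_all add: zero_U_gl12.abs_eq \<iota>.abs_eq U_scalar.abs_eq U_act_abs
      free_act_zero free_act_fgen free_act_fscalar)

lemma U_act_add: "U_act (u + u') w = U_act u w + U_act u' w"
  by (induction u rule: U_gl12.abs_induct, induction u' rule: U_gl12.abs_induct)
     (simp add: plus_U_gl12.abs_eq U_act_abs free_act_add)

lemma U_act_mult: "U_act (u * u') w = U_act u (U_act u' w)"
  by (induction u rule: U_gl12.abs_induct, induction u' rule: U_gl12.abs_induct)
     (simp add: times_U_gl12.abs_eq U_act_abs free_act_mult)

end


section \<open>Kac modules of \<open>gl(1|2)\<close>\<close>

text \<open>
  Let \<open>gl(1|2)\<close> act by \<open>E\<^sub>i\<^sub>j = z\<^sub>i \<partial>\<^sub>j\<close> on expressions in an even variable \<open>z\<^sub>1 = x\<close> and odd variables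
  \<open>z\<^sub>2, z\<^sub>3\<close>. Those of degree \<open>s\<close> have the basis
    \<open>x\<^sup>s\<close>, \<open>x\<^bsup>s-1\<^esup> z\<^sub>2\<close>, \<open>x\<^bsup>s-1\<^esup> z\<^sub>3\<close>, \<open>x\<^bsup>s-2\<^esup> z\<^sub>2 z\<^sub>3\<close>,
  and the formula is the resulting action in these coordinates. It depends polynomially on
  \<open>s\<close>, so it makes sense for every complex \<open>s\<close>. The element \<open>p\<close> acts diagonally, with eigenvalues
  \<open>2s\<close>, \<open>2s-1\<close>, \<open>2s-1\<close>, \<open>2s-2\<close>.
\<close>
definition kac_act :: "complex \<Rightarrow> gl12 \<Rightarrow> complex ^ 4 \<Rightarrow> complex ^ 4" where
  "kac_act s x w = vector
    [s * x$1$1 * w$1 + x$1$2 * w$2 + x$1$3 * w$3,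
     s * x$2$1 * w$1 + ((s-1) * x$1$1 + x$2$2) * w$2 + x$2$3 * w$3 - x$1$3 * w$4,
     s * x$3$1 * w$1 + x$3$2 * w$2 + ((s-1) * x$1$1 + x$3$3) * w$3 + x$1$2 * w$4,
     - (s-1) * x$3$1 * w$2 + (s-1) * x$2$1 * w$3 + ((s-2) * x$1$1 + x$2$2 + x$3$3) * w$4]"

lemma vector_4:
  fixes a b c d :: "'a::zero"
  shows "(vector [a, b, c, d] :: 'a ^ 4) $ 1 = a" "(vector [a, b, c, d] :: 'a ^ 4) $ 2 = b"
    "(vector [a, b, c, d] :: 'a ^ 4) $ 3 = c" "(vector [a, b, c, d] :: 'a ^ 4) $ 4 = d"
  unfolding vector_def by simp_all

lemma hom_part_homogeneous:
  assumes "homogeneous d x"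
  shows "hom_part e x = (if e = d then x else 0)"
proof -
  have x: "hom_part d x = x" and "d < 2" using assms by (auto simp: homogeneous_def)
  have "hom_part e x = hom_part e (hom_part d x)" by (simp add: x)
  also have "\<dots> = (if e = d then hom_part d x else 0)"
    by (auto simp: hom_part_def vec_eq_iff)
  finally show ?thesis by (simp add: x)
qed

lemma supercomm_homogeneous:
  assumes "homogeneous d x" "homogeneous e y"
  shows "supercomm x y = x ** y - (-1) ^ (d * e) *\<^sub>R (y ** x)"
proof -
  have "d < 2" "e < 2" using assms by (auto simp: homogeneous_def)
  then have "d = 0 \<or> d = 1" "e = 0 \<or> e = 1" by auto
  then show ?thesis
    by (auto simp: supercomm_def hom_part_homogeneous[OF assms(1)] hom_part_homogeneous[OF assms(2)]
        numeral_2_eq_2)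
qed

lemma index_parity_simps: "index_parity 1 = 0" "index_parity 2 = 1" "index_parity 3 = 1"
  by (simp_all add: index_parity_def)

lemma homogeneous_0_iff:
  "homogeneous 0 x \<longleftrightarrow> x$1$2 = 0 \<and> x$1$3 = 0 \<and> x$2$1 = 0 \<and> x$3$1 = 0"
  by (auto simp: homogeneous_def hom_part_def vec_eq_iff forall_3 index_parity_simps)

lemma homogeneous_1_iff:
  "homogeneous (Suc 0) x \<longleftrightarrow>
     x$1$1 = 0 \<and> x$2$2 = 0 \<and> x$2$3 = 0 \<and> x$3$2 = 0 \<and> x$3$3 = 0"
  by (auto simp: homogeneous_def hom_part_def vec_eq_iff forall_3 index_parity_simps)

lemma kac_act_supercomm:
  assumes "homogeneous d x" "homogeneous e y"
  shows "kac_act s (supercomm x y) w =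
    kac_act s x (kac_act s y w) - (-1) ^ (d * e) *s kac_act s y (kac_act s x w)"
proof -
  have "d < 2" "e < 2" using assms by (auto simp: homogeneous_def)
  then consider "d = 0" "e = 0" | "d = 0" "e = Suc 0" | "d = Suc 0" "e = 0" | "d = Suc 0" "e = Suc 0"
    by linarith
  then show ?thesis
    unfolding supercomm_homogeneous[OF assms]
    using assms
    by (cases; simp add: homogeneous_0_iff homogeneous_1_iff;
        simp add: kac_act_def vec_eq_iff forall_4 vector_4 matrix_matrix_mult_def sum_3;
        simp add: algebra_simps)
qed

interpretation kac: gl12_module "kac_act s" for s
proof
  fix x y :: gl12 and w w' :: "complex ^ 4" and c :: complex and d e :: nat
  show "kac_act s (x + y) w = kac_act s x w + kac_act s y w"
    "kac_act s (map_matrix ((*) c) x) w = c *s kac_act s x w"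
    "kac_act s x (w + w') = kac_act s x w + kac_act s x w'"
    "kac_act s x (c *s w) = c *s kac_act s x w"
    by (simp_all add: kac_act_def vec_eq_iff forall_4 vector_4 map_matrix_def algebra_simps)
  show "kac_act s (supercomm x y) w =
      kac_act s x (kac_act s y w) - (-1) ^ (d * e) *s kac_act s y (kac_act s x w)"
    if "homogeneous d x" "homogeneous e y"
    using that by (rule kac_act_supercomm)
qed


section \<open>Polynomials in an element of the enveloping algebra\<close>

lemma fscalar_commute: "fscalar c * a = a * fscalar c"
  by (induction a rule: free_alg_induct)
     (simp_all add: fscalar_def mult_single distrib_left distrib_right mult.commute)

lemma U_scalar_commute: "U_scalar c * u = u * U_scalar c"
  by (induction u rule: U_gl12.abs_induct)
     (simp add: U_scalar.abs_eq times_U_gl12.abs_eq fscalar_commute)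

lemma U_scalar_0: "U_scalar 0 = 0"
  by (simp add: U_scalar.abs_eq zero_U_gl12.abs_eq fscalar_def)

lemma U_scalar_1: "U_scalar 1 = 1"
  by (simp add: U_scalar.abs_eq one_U_gl12.abs_eq fscalar_def)

lemma U_scalar_add: "U_scalar (c + d) = U_scalar c + U_scalar d"
  by (simp add: U_scalar.abs_eq plus_U_gl12.abs_eq fscalar_def single_add)

lemma U_scalar_mult: "U_scalar (c * d) = U_scalar c * U_scalar d"
  by (simp add: U_scalar.abs_eq times_U_gl12.abs_eq fscalar_def mult_single)

lemma U_poly_0: "U_poly 0 u = 0"
  by (simp add: U_poly_def U_scalar_0)

lemma U_poly_pCons: "U_poly (pCons a q) u = U_scalar a + u * U_poly q u"
proof (cases "q = 0")
  case False
  have move: "U_scalar c * u ^ Suc i = u * (U_scalar c * u ^ i)" for c i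
    by (metis U_scalar_commute mult.assoc power_Suc)
  have "U_poly (pCons a q) u = U_scalar a + (\<Sum>i\<le>degree q. U_scalar (coeff q i) * u ^ Suc i)"
    using False by (simp add: U_poly_def sum.atMost_Suc_shift del: power_Suc sum.atMost_Suc)
  also have "(\<Sum>i\<le>degree q. U_scalar (coeff q i) * u ^ Suc i) = u * U_poly q u"
    by (simp add: U_poly_def sum_distrib_left move del: power_Suc)
  finally show ?thesis .
qed (simp add: U_poly_def U_scalar_0)

lemma U_poly_add: "U_poly (q + r) u = U_poly q u + U_poly r u"
  by (induction q r rule: poly_induct2)
     (simp_all add: U_poly_0 U_poly_pCons U_scalar_add algebra_simps)

lemma U_poly_diff: "U_poly (q - r) u = U_poly q u - U_poly r u"
  using U_poly_add[of "q - r" r u] by simp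

lemma U_poly_smult: "U_poly (smult c q) u = U_scalar c * U_poly q u"
proof (induction q)
  case (pCons a q)
  have "u * (U_scalar c * U_poly q u) = U_scalar c * (u * U_poly q u)"
    by (metis U_scalar_commute mult.assoc)
  then show ?case
    using pCons by (simp add: U_poly_pCons U_scalar_mult distrib_left)
qed (simp add: U_poly_0)

lemma U_poly_monom: "U_poly (monom 1 n) u = u ^ n"
  by (induction n)
     (simp_all add: monom_0 monom_Suc U_poly_pCons U_poly_0 U_scalar_0 U_scalar_1)

text \<open>
  An eigenvector \<open>e\<close> of the commutator with \<open>u\<close>, of eigenvalue \<open>c\<close>, moves past polynomials in \<open>u\<close>
  at the price of a shift of the argument by \<open>c\<close>.
\<close>
lemma U_poly_shift_commute:
  assumes "u * e = e * (u + U_scalar c)"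
  shows "U_poly q u * e = e * U_poly (pcompose q [:c, 1:]) u"
proof (induction q)
  case (pCons a q)
  let ?r = "U_poly (pcompose q [:c, 1:]) u"
  have "U_poly (pCons a q) u * e = e * U_scalar a + u * e * ?r"
    by (simp add: U_poly_pCons distrib_right mult.assoc pCons U_scalar_commute)
  also have "\<dots> = e * (U_scalar a + (u + U_scalar c) * ?r)"
    by (simp only: assms distrib_left distrib_right mult.assoc)
  also have "U_scalar a + (u + U_scalar c) * ?r = U_poly (pcompose (pCons a q) [:c, 1:]) u"
    by (simp add: pcompose_pCons U_poly_add U_poly_pCons U_poly_0 U_poly_smult U_scalar_0
        algebra_simps)
  finally show ?case .
qed (simp add: U_poly_0)

lemma (in gl12_module) U_act_U_poly:
  assumes "act x w = \<mu> *s w"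
  shows "U_act (U_poly q (\<iota> x)) w = poly q \<mu> *s w"
proof (induction q)
  case (pCons a q)
  then show ?case
    using assms
    by (simp add: U_poly_pCons U_act_add U_act_mult U_act_simps act_scale_right
        vec.scale_left_distrib mult.commute)
qed (simp add: U_poly_0 U_act_simps)


section \<open>Weight vectors for the adjoint action of \<open>p\<close>\<close>

definition v_row :: "complex ^ 2 \<Rightarrow> gl12" where
  "v_row v = vector [vector [0, v $ 1, v $ 2], vector [0, 0, 0], vector [0, 0, 0]]"

definition v_col :: "complex ^ 2 \<Rightarrow> gl12" where
  "v_col v = vector [vector [0, 0, 0], vector [- (v $ 2), 0, 0], vector [v $ 1, 0, 0]]"

lemma \<iota>_add: "\<iota> (x + y) = \<iota> x + \<iota> y"
proof -
  have "fgen (x + y) - (fgen x + fgen y) \<in> env_ideal"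
    using env_ideal.add[of x y] by (simp add: algebra_simps)
  then show ?thesis
    by (simp add: \<iota>.abs_eq plus_U_gl12.abs_eq U_gl12.abs_eq_iff)
qed

lemma \<iota>_diff: "\<iota> (x - y) = \<iota> x - \<iota> y"
  using \<iota>_add[of "x - y" y] by simp

text \<open>
  No sign occurs when one of the factors is even, so the super relation is the ordinary one.
\<close>
lemma \<iota>_comm_even:
  assumes "homogeneous 0 x" "homogeneous e y"
  shows "\<iota> x * \<iota> y - \<iota> y * \<iota> x = \<iota> (x ** y - y ** x)"
proof -
  have "fgen x * fgen y - fgen y * fgen x - fgen (x ** y - y ** x) \<in> env_ideal"
    using env_ideal.comm[OF assms] by (simp add: supercomm_homogeneous[OF assms])
  then show ?thesis
    by (simp add: \<iota>.abs_eq times_U_gl12.abs_eq minus_U_gl12.abs_eq U_gl12.abs_eq_iff)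
qed

lemmas gl12_entry_simps = vec_eq_iff forall_3 p_elt_def mat_unit_def v_row_def v_col_def
  v_k_def v_p_def matrix_matrix_mult_def sum_3 scaleR_conv_of_real

lemma v_k_row_col: "v_k v = v_row v + v_col v"
  by (simp add: gl12_entry_simps)

lemma v_p_row_col: "v_p v = v_row v - v_col v"
  by (simp add: gl12_entry_simps)

lemma p_v_row: "\<iota> p_elt * \<iota> (v_row v) = \<iota> (v_row v) * (\<iota> p_elt + U_scalar 1)"
proof -
  have "\<iota> p_elt * \<iota> (v_row v) - \<iota> (v_row v) * \<iota> p_elt = \<iota> (p_elt ** v_row v - v_row v ** p_elt)"
    by (rule \<iota>_comm_even[where e = "Suc 0"])
       (simp_all add: homogeneous_0_iff homogeneous_1_iff gl12_entry_simps)
  also have "p_elt ** v_row v - v_row v ** p_elt = v_row v"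
    by (simp add: gl12_entry_simps)
  finally show ?thesis by (simp add: U_scalar_1 algebra_simps)
qed

lemma p_v_col: "\<iota> p_elt * \<iota> (v_col v) = \<iota> (v_col v) * (\<iota> p_elt + U_scalar (- 1))"
proof -
  have "\<iota> p_elt * \<iota> (v_col v) - \<iota> (v_col v) * \<iota> p_elt = \<iota> (p_elt ** v_col v - v_col v ** p_elt)"
    by (rule \<iota>_comm_even[where e = "Suc 0"])
       (simp_all add: homogeneous_0_iff homogeneous_1_iff gl12_entry_simps)
  also have "p_elt ** v_col v - v_col v ** p_elt = 0 - v_col v"
    by (simp add: gl12_entry_simps)
  also have "\<iota> (0 - v_col v) = - \<iota> (v_col v)"
    using \<iota>_diff[of 0 0] unfolding \<iota>_diff[of 0 "v_col v"] by simp
  finally have "\<iota> p_elt * \<iota> (v_col v) = \<iota> (v_col v) * \<iota> p_elt - \<iota> (v_col v)"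
    by (simp add: algebra_simps)
  moreover have "U_scalar (- 1) = - 1"
    using U_scalar_add[of "-1" 1] by (simp add: U_scalar_0 U_scalar_1 eq_neg_iff_add_eq_0)
  ultimately show ?thesis by (simp add: algebra_simps)
qed

text \<open>
  In the Kac module with parameter \<open>s\<close>, apply the relation to an eigenvector of \<open>p\<close>. On the second
  basis vector, of eigenvalue \<open>2s-1\<close>, only the row part reaches the first coordinate, with
  coefficient \<open>P(2s-1)\<close>. On the first basis vector, of eigenvalue \<open>2s\<close>, the row part acts by zero
  and the column part gives \<open>s Q(2s)\<close>. Both must vanish for all \<open>s\<close>.
\<close>
lemma row_col_independent:
  assumes "\<And>v. \<iota> (v_row v) * U_poly P (\<iota> p_elt) + \<iota> (v_col v) * U_poly Q (\<iota> p_elt) = 0"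
  shows "P = 0" "Q = 0"
proof -
  define v :: "complex ^ 2" where "v = vector [1, 0]"
  define b :: "4 \<Rightarrow> complex ^ 4" where "b i = axis i 1" for i
  have zero: "kac.U_act s (\<iota> (v_row v) * U_poly P (\<iota> p_elt) + \<iota> (v_col v) * U_poly Q (\<iota> p_elt)) w = 0"
    for s w by (simp add: assms kac.U_act_zero)
  have act: "poly P \<mu> *s kac_act s (v_row v) w + poly Q \<mu> *s kac_act s (v_col v) w = 0"
    if "kac_act s p_elt w = \<mu> *s w" for s \<mu> w
    using zero[of s w]
    by (simp add: kac.U_act_add kac.U_act_mult kac.U_act_U_poly[OF that] kac.U_act_\<iota>
        kac.act_scale_right)
  have "poly P (2 * s - 1) = 0" for s
  proof -
    have "kac_act s p_elt (b 2) = (2 * s - 1) *s b 2"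
      by (simp add: kac_act_def b_def gl12_entry_simps forall_4 vector_4 axis_def algebra_simps)
    from arg_cong[OF act[OF this], of "\<lambda>w. w $ 1"] show ?thesis
      by (simp add: kac_act_def b_def v_def v_row_def v_col_def vector_4 axis_def)
  qed
  from this[of "(z + 1) / 2" for z] have "poly P z = 0" for z
    by (metis add_diff_cancel_right' nonzero_mult_div_cancel_left times_divide_eq_right zero_neq_numeral)
  then show "P = 0" by (simp only: poly_all_0_iff_0[symmetric] simp_thms)
  have "s * poly Q (2 * s) = 0" for s
  proof -
    have "kac_act s p_elt (b 1) = (2 * s) *s b 1"
      by (simp add: kac_act_def b_def gl12_entry_simps forall_4 vector_4 axis_def algebra_simps)
    from arg_cong[OF act[OF this], of "\<lambda>w. w $ 3"] show ?thesis
      by (auto simp: kac_act_def b_def v_def v_row_def v_col_def vector_4 axis_def)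
  qed
  \<comment> \<open>The factor \<open>s\<close> hides the value at \<open>0\<close>; keeping it as a polynomial factor recovers \<open>Q = 0\<close>.\<close>
  from this[of "z / 2" for z] have "\<forall>z. poly ([:0, 1:] * Q) z = 0" by simp
  then have "[:0, 1:] * Q = 0" by (simp only: poly_all_0_iff_0)
  then show "Q = 0" by simp
qed

text \<open>
  Writing both sides of the rule as \<open>e\<close> times a polynomial plus \<open>f\<close> times a polynomial, the
  independence of the two parts allows coefficients to be compared.
\<close>
lemma commutation_rule_iff:
  "commutation_rule n A B \<longleftrightarrow>
     A + pcompose B [:1, 1:] = [:1, 1:] ^ n \<and> A - pcompose B [:-1, 1:] = [:-1, 1:] ^ n"
proof -
  define P where "P = A + pcompose B [:1, 1:] - [:1, 1:] ^ n"
  define Q where "Q = A - pcompose B [:-1, 1:] - [:-1, 1:] ^ n"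
  let ?p = "\<iota> p_elt"
  have pow: "pcompose (monom 1 n) r = r ^ n" for r :: "complex poly"
    by (induction n) (simp_all add: monom_0 monom_Suc pcompose_pCons pcompose_1 one_pCons[symmetric])
  have lhs: "?p ^ n * \<iota> (v_k v)
      = \<iota> (v_row v) * U_poly ([:1, 1:] ^ n) ?p + \<iota> (v_col v) * U_poly ([:-1, 1:] ^ n) ?p" for v
    unfolding v_k_row_col \<iota>_add distrib_left U_poly_monom[symmetric]
      U_poly_shift_commute[OF p_v_row] U_poly_shift_commute[OF p_v_col] pow ..
  have rhs: "\<iota> (v_k v) * U_poly A ?p + U_poly B ?p * \<iota> (v_p v)
      = \<iota> (v_row v) * U_poly (A + pcompose B [:1, 1:]) ?p
        + \<iota> (v_col v) * U_poly (A - pcompose B [:-1, 1:]) ?p" for v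
    unfolding v_k_row_col v_p_row_col \<iota>_add \<iota>_diff right_diff_distrib U_poly_add U_poly_diff
      U_poly_shift_commute[OF p_v_row] U_poly_shift_commute[OF p_v_col]
    by (simp add: algebra_simps)
  have "commutation_rule n A B \<longleftrightarrow>
      (\<forall>v. \<iota> (v_row v) * U_poly P ?p + \<iota> (v_col v) * U_poly Q ?p = 0)"
    unfolding commutation_rule_def lhs rhs P_def Q_def U_poly_diff[of _ "_ ^ n"]
    by (intro all_cong1) (auto simp: algebra_simps)
  also have "\<dots> \<longleftrightarrow> P = 0 \<and> Q = 0"
    using row_col_independent[of P Q] by (auto simp: U_poly_0)
  finally show ?thesis by (simp add: P_def Q_def)
qed

text \<open>
  A shift of the argument keeps the leading coefficient, so the sum of the two shifts has leading
  coefficient twice that of \<open>q\<close>.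
\<close>
lemma central_sum_eq_0_imp_eq_0:
  fixes q :: "complex poly"
  assumes "pcompose q [:1, 1:] + pcompose q [:-1, 1:] = 0"
  shows "q = 0"
proof -
  have "coeff (pcompose q [:c, 1:]) (degree q) = lead_coeff q" for c
    using lead_coeff_comp[of "[:c, 1:]" q] degree_pcompose[of q "[:c, 1:]"] by simp
  then have "2 * lead_coeff q = 0"
    using arg_cong[OF assms, of "\<lambda>r. coeff r (degree q)"] by simp
  then show ?thesis by simp
qed

text \<open>
  This reduces the problem to exhibiting one solution of the difference equation that is left when
  \<open>A\<close> is eliminated. The difference equation determines \<open>B\<close>, and \<open>B\<close> determines \<open>A\<close>, so the
  definite description of the pair is well defined.
\<close>
lemma beta_poly_eqI:
  assumes "n \<ge> 1"
    and B: "pcompose B [:1, 1:] + pcompose B [:-1, 1:] = [:1, 1:] ^ n - [:-1, 1:] ^ n"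
  shows "beta_poly (int n - 1) = B"
proof -
  let ?A = "[:1, 1:] ^ n - pcompose B [:1, 1:]"
  have AB: "commutation_rule n ?A B"
    using B by (simp add: commutation_rule_iff algebra_simps)
  have unique: "A' = ?A \<and> B' = B" if "commutation_rule n A' B'" for A' B'
  proof -
    have A'_row: "A' + pcompose B' [:1, 1:] = [:1, 1:] ^ n"
      and A'_col: "A' - pcompose B' [:-1, 1:] = [:-1, 1:] ^ n"
      using that by (simp_all only: commutation_rule_iff)
    have "pcompose (B' - B) [:1, 1:] + pcompose (B' - B) [:-1, 1:]
        = (pcompose B' [:1, 1:] + pcompose B' [:-1, 1:])
          - (pcompose B [:1, 1:] + pcompose B [:-1, 1:])"
      by (simp only: pcompose_diff algebra_simps)
    also have "\<dots> = 0"
      unfolding B A'_row[symmetric] A'_col[symmetric] by simp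
    finally have "B' = B"
      using central_sum_eq_0_imp_eq_0[of "B' - B"] by simp
    moreover have "A' = [:1, 1:] ^ n - pcompose B' [:1, 1:]"
      unfolding A'_row[symmetric] by simp
    ultimately show ?thesis by simp
  qed
  have "alpha_beta n = (?A, B)"
    unfolding alpha_beta_def
  proof (rule the_equality)
    show "case (?A, B) of (A, B) \<Rightarrow> commutation_rule n A B"
      using AB by (simp only: prod.case)
  next
    fix r assume "case r of (A, B) \<Rightarrow> commutation_rule n A B"
    then show "r = (?A, B)"
      using unique[of "fst r" "snd r"] by (simp only: case_prod_beta prod_eq_iff fst_conv snd_conv)
  qed
  with assms(1) show ?thesis by (simp add: beta_poly_def)
qed


section \<open>The hyperbolic tangent and Bernoulli numbers\<close>

definition tanh_fps :: "complex fps" where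
  "tanh_fps = (fps_exp 1 - fps_exp (- 1)) / (fps_exp 1 + fps_exp (- 1))"

lemma tanh_fps_mult: "tanh_fps * (fps_exp 1 + fps_exp (- 1)) = fps_exp 1 - fps_exp (- 1)"
  unfolding tanh_fps_def by (rule dvd_div_mult_self) (simp add: fps_is_unit_iff)

lemma fps_exp_cosh_neq_0: "fps_exp 1 + fps_exp (- 1) \<noteq> (0 :: complex fps)"
proof
  assume "fps_exp 1 + fps_exp (- 1) = (0 :: complex fps)"
  from arg_cong[OF this, of "\<lambda>f. fps_nth f 0"] show False by simp
qed

text \<open>
  Substituting \<open>-t\<close> for \<open>t\<close> changes the sign of \<open>2 sinh\<close> and fixes \<open>2 cosh\<close>, so \<open>tanh\<close> is odd.
\<close>
lemma tanh_fps_even_nth: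
  assumes "even j"
  shows "fps_nth tanh_fps j = 0"
proof -
  let ?H' = "tanh_fps oo (fps_const (- 1) * fps_X)"
  have X0: "fps_nth (fps_const (- 1) * fps_X :: complex fps) 0 = 0" by simp
  have "?H' * (fps_exp 1 + fps_exp (- 1)) = - (fps_exp 1 - fps_exp (- 1))"
    using arg_cong[OF tanh_fps_mult, of "\<lambda>f. f oo (fps_const (- 1) * fps_X)"]
    by (simp only: fps_compose_mult_distrib[OF X0] fps_compose_add_distrib fps_compose_sub_distrib
        fps_exp_compose_linear) (simp add: add.commute)
  also have "\<dots> = (- tanh_fps) * (fps_exp 1 + fps_exp (- 1))"
    by (simp add: tanh_fps_mult)
  finally have "?H' = - tanh_fps" using fps_exp_cosh_neq_0 by (simp only: mult_cancel_right) simp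
  from arg_cong[OF this, of "\<lambda>f. fps_nth f j"] have "fps_nth tanh_fps j = - fps_nth tanh_fps j"
    using assms by (simp only: fps_nth_compose_linear) simp
  then show ?thesis by (simp add: eq_neg_iff_add_eq_0)
qed

text \<open>
  With \<open>E = exp(2 t)\<close> the functional equations of the terms are \<open>G(2t) (E - 1) = 2t\<close>,
  \<open>G(4t) (E\<^sup>2 - 1) = 4t\<close> and \<open>tanh(t) (E + 1) = E - 1\<close>. After multiplication by \<open>E\<^sup>2 - 1\<close> the claim
  is thus \<open>t (E - 1)\<^sup>2 = t (E\<^sup>2 - 1) + 4t - 2t (E + 1)\<close>.
\<close>
lemma tanh_fps_bernoulli:
  defines "G \<equiv> fps_X / (fps_exp 1 - 1) :: complex fps"
  shows "fps_X * tanh_fps = fps_X + (G oo (fps_const 4 * fps_X)) - (G oo (fps_const 2 * fps_X))"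
proof -
  have neq: "fps_exp c - 1 \<noteq> (0 :: complex fps)" if "c \<noteq> 0" for c
    using that by simp
  have "subdegree (fps_exp 1 - 1 :: complex fps) \<le> 1"
    by (rule subdegree_leI) simp
  then have "(fps_exp 1 - 1 :: complex fps) dvd fps_X"
    using neq[of 1] by (simp add: fps_dvd_iff)
  then have G: "G * (fps_exp 1 - 1) = fps_X"
    unfolding G_def by (rule dvd_div_mult_self)
  have Gc: "(G oo (fps_const c * fps_X)) * (fps_exp c - 1) = fps_const c * fps_X" for c
    using arg_cong[OF G, of "\<lambda>f. f oo (fps_const c * fps_X)"]
    by (simp add: fps_compose_mult_distrib fps_compose_sub_distrib)
  define E where "E = (fps_exp 2 :: complex fps)"
  have E1: "fps_exp 1 * fps_exp 1 = E" "fps_exp 1 * fps_exp (- 1) = (1 :: complex fps)"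
    and E4: "fps_exp 4 = E * E"
    by (simp_all add: E_def fps_exp_add_mult[symmetric])
  have "tanh_fps * (fps_exp 1 * fps_exp 1 + fps_exp 1 * fps_exp (- 1))
      = fps_exp 1 * fps_exp 1 - fps_exp 1 * fps_exp (- 1)"
    using arg_cong[OF tanh_fps_mult, of "\<lambda>f. fps_exp 1 * f"] by (simp add: algebra_simps)
  then have H: "tanh_fps * (E + 1) = E - 1" by (simp only: E1)
  let ?G2 = "G oo (fps_const 2 * fps_X)" and ?G4 = "G oo (fps_const 4 * fps_X)"
  have G2: "?G2 * (E - 1) = 2 * fps_X" and G4: "?G4 * (E * E - 1) = 4 * fps_X"
    using Gc[of 2] Gc[of 4] by (simp_all add: E_def[symmetric] E4 numeral_fps_const)
  have "(fps_X * tanh_fps) * (E * E - 1) = fps_X * (tanh_fps * (E + 1)) * (E - 1)"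
    by (simp add: algebra_simps)
  also have "\<dots> = fps_X * (E * E - 1) + 4 * fps_X - 2 * fps_X * (E + 1)"
    unfolding H by (simp add: algebra_simps)
  also have "\<dots> = fps_X * (E * E - 1) + ?G4 * (E * E - 1) - ?G2 * (E - 1) * (E + 1)"
    unfolding G2 G4 ..
  also have "\<dots> = (fps_X + ?G4 - ?G2) * (E * E - 1)"
    by (simp add: algebra_simps)
  finally show ?thesis
    using neq[of 4] by (simp only: E4 mult_cancel_right) simp
qed

lemma tanh_fps_nth_odd:
  "fact (2 * k + 1) * fps_nth tanh_fps (2 * k + 1) =
     2 ^ (2 * k + 2) * (2 ^ (2 * k + 2) - 1) * bernoulli (2 * k + 2) / of_nat (2 * k + 2)"
proof -
  define G :: "complex fps" where "G = fps_X / (fps_exp 1 - 1)"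
  have "fps_nth tanh_fps (2 * k + 1) = fps_nth (fps_X * tanh_fps) (2 * k + 2)"
    by simp
  also have "\<dots> = (4 ^ (2 * k + 2) - 2 ^ (2 * k + 2)) * fps_nth G (2 * k + 2)"
    unfolding tanh_fps_bernoulli G_def[symmetric] fps_add_nth fps_sub_nth fps_nth_compose_linear
    by (simp add: left_diff_distrib)
  also have "(4 :: complex) ^ (2 * k + 2) = 2 ^ (2 * k + 2) * 2 ^ (2 * k + 2)"
    by (simp add: power_mult_distrib[symmetric])
  finally have "fact (2 * k + 1) * fps_nth tanh_fps (2 * k + 1)
      = 2 ^ (2 * k + 2) * (2 ^ (2 * k + 2) - 1) * (fact (2 * k + 1) * fps_nth G (2 * k + 2))"
    by (simp only: right_diff_distrib left_diff_distrib mult_ac mult_1_left mult_1_right)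
  moreover have "bernoulli (2 * k + 2) = of_nat (2 * k + 2) * (fact (2 * k + 1) * fps_nth G (2 * k + 2))"
    unfolding bernoulli_def G_def by (simp add: mult.assoc del: of_nat_add of_nat_mult)
  moreover have "of_nat (2 * k + 2) \<noteq> (0 :: complex)" by (simp only: of_nat_eq_0_iff)
  ultimately show ?thesis by simp
qed

text \<open>
  The Appell sequence of \<open>tanh\<close>, that is, the polynomials with exponential generating function
  \<open>tanh(t) exp(x t)\<close>.
\<close>
definition tanh_appell :: "nat \<Rightarrow> complex poly" where
  "tanh_appell n = (\<Sum>j\<le>n. monom (fact j * fps_nth tanh_fps j * of_nat (n choose j)) (n - j))"

lemma poly_tanh_appell: "poly (tanh_appell n) z = fact n * fps_nth (tanh_fps * fps_exp z) n"
proof -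
  have "(fact j * fps_nth tanh_fps j * of_nat (n choose j)) * z ^ (n - j)
      = fact n * (fps_nth tanh_fps j * (z ^ (n - j) / fact (n - j)))" if "j \<le> n" for j
    using that by (simp add: binomial_fact)
  then show ?thesis
    by (simp add: tanh_appell_def poly_sum poly_monom fps_mult_nth sum_distrib_left atMost_atLeast0)
qed

text \<open>
  At a fixed point \<open>z\<close> this compares coefficients in
  \<open>tanh(t) (exp(t) + exp(-t)) exp(z t) = (exp(t) - exp(-t)) exp(z t)\<close>.
\<close>
lemma tanh_appell_central_sum:
  "pcompose (tanh_appell n) [:1, 1:] + pcompose (tanh_appell n) [:-1, 1:]
     = [:1, 1:] ^ n - [:-1, 1:] ^ n"
proof -
  let ?H = tanh_fps
  have "poly (pcompose (tanh_appell n) [:1, 1:] + pcompose (tanh_appell n) [:-1, 1:]) z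
      = poly ([:1, 1:] ^ n - [:-1, 1:] ^ n) z" for z
  proof -
    have "?H * fps_exp (1 + z) + ?H * fps_exp (- 1 + z)
        = ?H * (fps_exp 1 + fps_exp (- 1)) * fps_exp z"
      by (simp only: fps_exp_add_mult) (simp add: algebra_simps)
    also have "\<dots> = fps_exp (1 + z) - fps_exp (- 1 + z)"
      unfolding tanh_fps_mult by (simp only: fps_exp_add_mult) (simp add: algebra_simps)
    finally have sum: "?H * fps_exp (1 + z) + ?H * fps_exp (- 1 + z)
        = fps_exp (1 + z) - fps_exp (- 1 + z)" .
    have "fps_nth (?H * fps_exp (1 + z)) n + fps_nth (?H * fps_exp (- 1 + z)) n
        = (1 + z) ^ n / fact n - (- 1 + z) ^ n / fact n"
      using arg_cong[OF sum, of "\<lambda>f. fps_nth f n"]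
      by (simp only: fps_add_nth fps_sub_nth fps_exp_nth of_nat_fact)
    then have "fact n * (fps_nth (?H * fps_exp (1 + z)) n + fps_nth (?H * fps_exp (- 1 + z)) n)
        = (1 + z) ^ n - (- 1 + z) ^ n"
      by (simp add: right_diff_distrib)
    then show ?thesis
      by (simp add: poly_pcompose poly_tanh_appell distrib_left)
  qed
  then show ?thesis by (simp only: poly_eq_poly_eq_iff[symmetric] fun_eq_iff) blast
qed

lemma tanh_appell_odd_terms:
  assumes "n \<ge> 1"
  shows "tanh_appell n = (\<Sum>k = 0..(n - 1) div 2.
    monom (fact (2 * k + 1) * fps_nth tanh_fps (2 * k + 1) * of_nat (n choose (n - 1 - 2 * k)))
      (n - 1 - 2 * k))"
proof -
  let ?t = "\<lambda>j. monom (fact j * fps_nth tanh_fps j * of_nat (n choose j)) (n - j)"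
  have "tanh_appell n = (\<Sum>j | j \<le> n \<and> odd j. ?t j)"
    unfolding tanh_appell_def
    by (rule sum.mono_neutral_right) (auto simp: tanh_fps_even_nth)
  also have "\<dots> = (\<Sum>k = 0..(n - 1) div 2. ?t (2 * k + 1))"
    by (rule sum.reindex_bij_witness[of _ "\<lambda>k. 2 * k + 1" "\<lambda>j. j div 2"])
       (use assms in \<open>auto elim!: oddE\<close>)
  also have "\<dots> = (\<Sum>k = 0..(n - 1) div 2.
    monom (fact (2 * k + 1) * fps_nth tanh_fps (2 * k + 1) * of_nat (n choose (n - 1 - 2 * k)))
      (n - 1 - 2 * k))"
  proof (intro sum.cong refl)
    fix k assume "k \<in> {0..(n - 1) div 2}"
    then have "2 * k + 1 \<le> n" using assms by auto
    then have "n choose (2 * k + 1) = n choose (n - 1 - 2 * k)" "n - (2 * k + 1) = n - 1 - 2 * k"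
      by (subst binomial_symmetric) simp_all
    then show "?t (2 * k + 1) = monom (fact (2 * k + 1) * fps_nth tanh_fps (2 * k + 1)
        * of_nat (n choose (n - 1 - 2 * k))) (n - 1 - 2 * k)"
      by (simp only:)
  qed
  finally show ?thesis .
qed


section \<open>The polynomials \<open>\<beta>\<^sub>n\<^sub>-\<^sub>1\<close>\<close>

theorem proposition4p5:
  fixes n :: nat
  assumes "n \<ge> 1"
  shows "beta_poly (int n - 1) =
    (\<Sum>k = 0..(n - 1) div 2.
       monom (2 ^ (2 * k + 2) * (2 ^ (2 * k + 2) - 1) * bernoulli (2 * k + 2) / of_nat (2 * k + 2)
              * of_nat (n choose (n - 1 - 2 * k)))
         (n - 1 - 2 * k))"
  unfolding beta_poly_eqI[OF assms tanh_appell_central_sum] tanh_appell_odd_terms[OF assms]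
    tanh_fps_nth_odd ..

end
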